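(* Let $r\ge 1$, let $\mathbf m\in\mathcal M_r$ be a Motzkin path, and let $T'_{\mathbf m}$ be the transfer matrix of the compactified graph $\Gamma'_{\mathbf m}$. Write $T'_{\mathbf m}=N_{\mathbf m}+B_{\mathbf m}$ with $N_{\mathbf m}$ strictly lower triangular and $B_{\mathbf m}$ upper triangular. Let $\sigma_{\mathbf m}=(i_1,\dots,i_r)$ and $\tau_{\mathbf m}=(j_1,\dots,j_r)$. Then $$N_{\mathbf m}=I-(f_{i_1}f_{i_2}\cdots f_{i_r})^{-1},\qquad B_{\mathbf m}=t\,(d_1d_2\cdots d_{r+1})\,(e_{j_1}e_{j_2}\cdots e_{j_r}).$$
   Context: Motzkin paths: $\mathcal M_r$ is the set of integer vectors $\mathbf m=(m_1,\dots,m_r)$ with $|m_\alpha-m_{\alpha+1}|\le 1$ for $1\le\alpha<r$ and $\min_\alpha m_\alpha=0$. A maximal ascending (resp. descending) segment of $\mathbf m$ is a maximal interval $[\alpha,\beta]\subset\{1,\dots,r\}$, $\beta>\alpha$, of consecutive indices with $m_{\alpha+j}=m_\alpha+j$ (resp. $m_{\alpha+j}=m_\alpha-j$) for $0\le j\le\beta-\alpha$. $Q$-system: $\{R_{\alpha,n}\}_{0\le\alpha\le r+1,n\in\mathbb Z}$ is the solution of $R_{\alpha,n+1}R_{\alpha,n-1}=R_{\alpha,n}^2+R_{\alpha+1,n}R_{\alpha-1,n}$ ($1\le\alpha\le r$), $R_{0,n}=R_{r+1,n}=1$, with initial data $R_{\alpha,0},R_{\alpha,1}$ ($1\le\alpha\le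 r$) independent indeterminates. Weights: put $\lambda_{\alpha,n}=R_{\alpha,n+1}/R_{\alpha,n}$ and $\mu_{\alpha,n}=R_{\alpha,n}/R_{\alpha-1,n}$. For $1\le \alpha\le r+1$, $y_{2\alpha-1}=\lambda_{\alpha,m_\alpha}/\lambda_{\alpha-1,m_{\alpha-1}}$; for $1\le\alpha\le r$, $y_{2\alpha}=\frac{\mu_{\alpha+1,m_\alpha+1}}{\mu_{\alpha,m_\alpha}}\,A_\alpha B_\alpha$, where $A_\alpha=\lambda_{\alpha+1,m_{\alpha+1}}/\lambda_{\alpha+1,m_\alpha}$ if $m_\alpha=m_{\alpha+1}+1$ and $A_\alpha=1$ otherwise, and $B_\alpha=\lambda_{\alpha-1,m_\alpha}/\lambda_{\alpha-1,m_{\alpha-1}}$ if $m_{\alpha-1}=m_\alpha+1$ and $B_\alpha=1$ otherwise. (Since $\lambda_{0,n}=\lambda_{r+1,n}=1$, the values of $m_0,m_{r+1}$ are irrelevant.) The compactified graph $\Gamma'_{\mathbf m}$ has vertices $1,\dots,r+1$; oriented edges $i\to i+1$ with weight $1$ and $i+1\to i$ with weight $t y_{2i}$ ($1\le i\le r$); loops $i\to i$ with weight $t y_{2i-1}$ ($1\le i\le r+1$). In addition: for every maximal descending segment $[\alpha,\alpha+i-1]$ of $\mathbf m$, $i\ge 2$, it has edges $\alpha+p\to\alpha+q$ for all $0\le q$, $q+2\le p\le i$, with weight $t\,\prod_{j=\alpha+q}^{\alpha+p-1}y_{2j}\big/\prod_{j=\alpha+q+1}^{\alpha+p-1}y_{2j-1}$;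 for every maximal ascending segment $[\alpha,\alpha+i-1]$, $i\ge2$, it has edges $\alpha+q\to\alpha+p$ for all $0\le q$, $q+2\le p\le i$, with weight $(-1)^{p-q-1}$. The transfer matrix $T'_{\mathbf m}$ is the $(r+1)\times(r+1)$ matrix whose $(b,a)$ entry (row $b$, column $a$) is the weight of the edge $a\to b$, or $0$ if there is none. Sequences: $\sigma_{\mathbf m}$ is obtained from the sequence $(r,r-1,\dots,1)$ by reversing, for each maximal ascending segment $[\alpha,\beta]$ of $\mathbf m$, the block $(\beta,\beta-1,\dots,\alpha)$ into $(\alpha,\alpha+1,\dots,\beta)$. $\tau_{\mathbf m}$ is obtained from $(r,r-1,\dots,1)$ in the same way using the maximal descending segments. For example, $\mathbf m=(2,1,2,2,2,1,0,0,1)$ gives $\sigma_{\mathbf m}=(8,9,7,6,5,4,2,3,1)$ and $\tau_{\mathbf m}=(9,8,5,6,7,4,3,1,2)$. Elementary matrices of size $(r+1)\times(r+1)$, with $E_{i,j}$ the matrix units: $f_i=I+E_{i+1,i}$ and $e_i=I+\frac{y_{2i}}{y_{2i-1}}E_{i,i+1}$ for $1\le i\le r$; $d_i=I+(y_{2i-1}-1)E_{i,i}$ for $1\le i\le r+1$. *)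

theory Defs
  imports
    "Jordan_Normal_Form.Gauss_Jordan_Elimination"
    "HOL-Library.Poly_Mapping"
    "HOL-Computational_Algebra.Fraction_Field"
begin

section \<open>Motzkin paths and their segments\<close>

text \<open>A path is a function on \<^typ>\<open>nat\<close> of which only the values at 1..r are constrained; the values
  at 0 and r+1, which the weights formally mention, are left arbitrary.\<close>

definition motzkin_path :: "nat \<Rightarrow> (nat \<Rightarrow> int) \<Rightarrow> bool" where
  "motzkin_path r m \<longleftrightarrow>
     (\<forall>\<alpha>. 1 \<le> \<alpha> \<and> \<alpha> < r \<longrightarrow> \<bar>m \<alpha> - m (\<alpha> + 1)\<bar> \<le> 1) \<and> Min (m ` {1..r}) = 0"

text \<open>The slope s is 1 for ascending and -1 for descending segments.\<close>

definition segment :: "nat \<Rightarrow> (nat \<Rightarrow> int) \<Rightarrow> int \<Rightarrow> nat \<Rightarrow> nat \<Rightarrow> bool" where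
  "segment r m s \<alpha> \<beta> \<longleftrightarrow>
     1 \<le> \<alpha> \<and> \<alpha> < \<beta> \<and> \<beta> \<le> r \<and> (\<forall>j \<le> \<beta> - \<alpha>. m (\<alpha> + j) = m \<alpha> + s * int j)"

definition max_segment :: "nat \<Rightarrow> (nat \<Rightarrow> int) \<Rightarrow> int \<Rightarrow> nat \<Rightarrow> nat \<Rightarrow> bool" where
  "max_segment r m s \<alpha> \<beta> \<longleftrightarrow>
     segment r m s \<alpha> \<beta> \<and> \<not> (\<exists>\<alpha>' \<beta>'. segment r m s \<alpha>' \<beta>' \<and> {\<alpha>..\<beta>} \<subset> {\<alpha>'..\<beta>'})"

abbreviation max_ascending :: "nat \<Rightarrow> (nat \<Rightarrow> int) \<Rightarrow> nat \<Rightarrow> nat \<Rightarrow> bool" where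
  "max_ascending r m \<equiv> max_segment r m 1"

abbreviation max_descending :: "nat \<Rightarrow> (nat \<Rightarrow> int) \<Rightarrow> nat \<Rightarrow> nat \<Rightarrow> bool" where
  "max_descending r m \<equiv> max_segment r m (-1)"


section \<open>The sequences \<open>\<sigma>\<close> and \<open>\<tau>\<close>\<close>

text \<open>In a rearrangement of (r, ..., 1), the positions originally holding \<open>\<beta>, ..., \<alpha>\<close> are
  (counting from 0) \<open>r - \<beta>, ..., r - \<alpha>\<close>; the list at these positions is reversed.\<close>

definition reverse_block :: "nat \<Rightarrow> nat \<times> nat \<Rightarrow> nat list \<Rightarrow> nat list" where
  "reverse_block r = (\<lambda>(\<alpha>, \<beta>) xs.
     take (r - \<beta>) xs @ rev (take (\<beta> - \<alpha> + 1) (drop (r - \<beta>) xs)) @ drop (r - \<alpha> + 1) xs)"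

text \<open>Maximal segments of a given non-zero slope are pairwise disjoint, so the order in which
  their blocks are reversed does not matter.\<close>

definition max_segments :: "nat \<Rightarrow> (nat \<Rightarrow> int) \<Rightarrow> int \<Rightarrow> (nat \<times> nat) list" where
  "max_segments r m s =
     filter (\<lambda>(\<alpha>, \<beta>). max_segment r m s \<alpha> \<beta>) (List.product [1..<r + 1] [1..<r + 1])"

definition sigma_seq :: "nat \<Rightarrow> (nat \<Rightarrow> int) \<Rightarrow> nat list" where
  "sigma_seq r m = fold (reverse_block r) (max_segments r m 1) (rev [1..<r + 1])"

definition tau_seq :: "nat \<Rightarrow> (nat \<Rightarrow> int) \<Rightarrow> nat list" where
  "tau_seq r m = fold (reverse_block r) (max_segments r m (-1)) (rev [1..<r + 1])"


section \<open>The Q-system\<close>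

text \<open>Rational functions over \<open>'k\<close> in countably many indeterminates \<open>x\<^sub>0, x\<^sub>1, \<dots>\<close>: the fraction field
  of the ring of polynomials, a polynomial being a finitely supported map from exponent vectors to
  coefficients.\<close>

type_synonym 'k ratfun = "((nat \<Rightarrow>\<^sub>0 nat) \<Rightarrow>\<^sub>0 'k) fract"

definition indet :: "nat \<Rightarrow> 'k::field_char_0 ratfun" where
  "indet v = Fract (Poly_Mapping.single (Poly_Mapping.single v 1) 1) 1"

text \<open>The initial data \<open>R\<^sub>\<alpha>\<^sub>,\<^sub>0\<close> and \<open>R\<^sub>\<alpha>\<^sub>,\<^sub>1\<close> are the distinct indeterminates numbered \<open>2\<alpha>\<close> and
  \<open>2\<alpha> + 1\<close>. The other indeterminates do not occur in R; in particular t may be one of them.\<close>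

definition q_system :: "nat \<Rightarrow> (nat \<Rightarrow> int \<Rightarrow> 'k::field_char_0 ratfun) \<Rightarrow> bool" where
  "q_system r R \<longleftrightarrow>
     (\<forall>\<alpha> n. 1 \<le> \<alpha> \<and> \<alpha> \<le> r \<longrightarrow>
        R \<alpha> (n + 1) * R \<alpha> (n - 1) = (R \<alpha> n)\<^sup>2 + R (\<alpha> + 1) n * R (\<alpha> - 1) n) \<and>
     (\<forall>n. R 0 n = 1 \<and> R (r + 1) n = 1) \<and>
     (\<forall>\<alpha>. 1 \<le> \<alpha> \<and> \<alpha> \<le> r \<longrightarrow> R \<alpha> 0 = indet (2 * \<alpha>) \<and> R \<alpha> 1 = indet (2 * \<alpha> + 1))"


section \<open>Weights\<close>

definition lam :: "(nat \<Rightarrow> int \<Rightarrow> 'a::field) \<Rightarrow> nat \<Rightarrow> int \<Rightarrow> 'a" where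
  "lam R \<alpha> n = R \<alpha> (n + 1) / R \<alpha> n"

definition mu :: "(nat \<Rightarrow> int \<Rightarrow> 'a::field) \<Rightarrow> nat \<Rightarrow> int \<Rightarrow> 'a" where
  "mu R \<alpha> n = R \<alpha> n / R (\<alpha> - 1) n"

definition weightA :: "(nat \<Rightarrow> int \<Rightarrow> 'a::field) \<Rightarrow> (nat \<Rightarrow> int) \<Rightarrow> nat \<Rightarrow> 'a" where
  "weightA R m \<alpha> =
     (if m \<alpha> = m (\<alpha> + 1) + 1 then lam R (\<alpha> + 1) (m (\<alpha> + 1)) / lam R (\<alpha> + 1) (m \<alpha>) else 1)"

definition weightB :: "(nat \<Rightarrow> int \<Rightarrow> 'a::field) \<Rightarrow> (nat \<Rightarrow> int) \<Rightarrow> nat \<Rightarrow> 'a" where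
  "weightB R m \<alpha> =
     (if m (\<alpha> - 1) = m \<alpha> + 1 then lam R (\<alpha> - 1) (m \<alpha>) / lam R (\<alpha> - 1) (m (\<alpha> - 1)) else 1)"

text \<open>The index \<open>\<alpha> = (k + 1) div 2\<close> satisfies \<open>k = 2\<alpha> - 1\<close> for odd k and \<open>k = 2\<alpha>\<close> for even k.\<close>

definition weight_y :: "(nat \<Rightarrow> int \<Rightarrow> 'a::field) \<Rightarrow> (nat \<Rightarrow> int) \<Rightarrow> nat \<Rightarrow> 'a" where
  "weight_y R m k =
     (let \<alpha> = (k + 1) div 2 in
      if odd k then lam R \<alpha> (m \<alpha>) / lam R (\<alpha> - 1) (m (\<alpha> - 1))
      else mu R (\<alpha> + 1) (m \<alpha> + 1) / mu R \<alpha> (m \<alpha>) * weightA R m \<alpha> * weightB R m \<alpha>)"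


section \<open>The compactified graph and its transfer matrix\<close>

text \<open>\<open>gamma_edge r m t y a b w\<close>: the graph has an edge from a to b of weight w.\<close>

inductive gamma_edge ::
  "nat \<Rightarrow> (nat \<Rightarrow> int) \<Rightarrow> 'a::field \<Rightarrow> (nat \<Rightarrow> 'a) \<Rightarrow> nat \<Rightarrow> nat \<Rightarrow> 'a \<Rightarrow> bool"
  for r :: nat and m :: "nat \<Rightarrow> int" and t :: "'a::field" and y :: "nat \<Rightarrow> 'a"
where
  up: "1 \<le> i \<Longrightarrow> i \<le> r \<Longrightarrow> gamma_edge r m t y i (i + 1) 1"
| down: "1 \<le> i \<Longrightarrow> i \<le> r \<Longrightarrow> gamma_edge r m t y (i + 1) i (t * y (2 * i))"
| loop: "1 \<le> i \<Longrightarrow> i \<le> r + 1 \<Longrightarrow> gamma_edge r m t y i i (t * y (2 * i - 1))"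
| descending: "i \<ge> 2 \<Longrightarrow> max_descending r m \<alpha> (\<alpha> + i - 1) \<Longrightarrow> q + 2 \<le> p \<Longrightarrow> p \<le> i \<Longrightarrow>
    gamma_edge r m t y (\<alpha> + p) (\<alpha> + q)
      (t * ((\<Prod>j\<in>{\<alpha> + q..\<alpha> + p - 1}. y (2 * j)) / (\<Prod>j\<in>{\<alpha> + q + 1..\<alpha> + p - 1}. y (2 * j - 1))))"
| ascending: "i \<ge> 2 \<Longrightarrow> max_ascending r m \<alpha> (\<alpha> + i - 1) \<Longrightarrow> q + 2 \<le> p \<Longrightarrow> p \<le> i \<Longrightarrow>
    gamma_edge r m t y (\<alpha> + q) (\<alpha> + p) ((-1) ^ (p - q - 1))"

text \<open>Matrix indices start at 0, so entry (b, a) in the usual numbering of rows and columns is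
  entry (b - 1, a - 1) here; likewise for the matrix units below. There is at most one edge between
  any two vertices in a given direction.\<close>

definition transfer_matrix ::
  "nat \<Rightarrow> (nat \<Rightarrow> int) \<Rightarrow> 'a::field \<Rightarrow> (nat \<Rightarrow> 'a) \<Rightarrow> 'a mat" where
  "transfer_matrix r m t y = mat (r + 1) (r + 1) (\<lambda>(b, a).
     if \<exists>w. gamma_edge r m t y (a + 1) (b + 1) w
     then THE w. gamma_edge r m t y (a + 1) (b + 1) w else 0)"

definition strictly_lower_triangular :: "'a::zero mat \<Rightarrow> bool" where
  "strictly_lower_triangular A \<longleftrightarrow> (\<forall>i < dim_row A. \<forall>j < dim_col A. i \<le> j \<longrightarrow> A $$ (i, j) = 0)"


section \<open>Elementary matrices\<close>

definition mat_unit :: "nat \<Rightarrow> nat \<Rightarrow> nat \<Rightarrow> 'a::field mat" where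
  "mat_unit r i j = mat (r + 1) (r + 1) (\<lambda>(a, b). if a + 1 = i \<and> b + 1 = j then 1 else 0)"

definition elem_f :: "nat \<Rightarrow> nat \<Rightarrow> 'a::field mat" where
  "elem_f r i = 1\<^sub>m (r + 1) + mat_unit r (i + 1) i"

definition elem_e :: "nat \<Rightarrow> (nat \<Rightarrow> 'a::field) \<Rightarrow> nat \<Rightarrow> 'a mat" where
  "elem_e r y i = 1\<^sub>m (r + 1) + (y (2 * i) / y (2 * i - 1)) \<cdot>\<^sub>m mat_unit r i (i + 1)"

definition elem_d :: "nat \<Rightarrow> (nat \<Rightarrow> 'a::field) \<Rightarrow> nat \<Rightarrow> 'a mat" where
  "elem_d r y i = 1\<^sub>m (r + 1) + (y (2 * i - 1) - 1) \<cdot>\<^sub>m mat_unit r i i"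

definition mat_prod :: "nat \<Rightarrow> 'a::field mat list \<Rightarrow> 'a mat" where
  "mat_prod r As = foldr (*) As (1\<^sub>m (r + 1))"

end

theory Submission
  imports Defs "HOL-Library.Sublist" "Jordan_Normal_Form.Determinant"
begin

text \<open>For a word w without repetitions, entry \<open>(a, b)\<close> of the product of the matrices
  \<open>I + c\<^sub>i E\<^sub>i\<^sub>,\<^sub>i\<^sub>+\<^sub>1\<close> along w is \<open>c\<^sub>a \<cdots> c\<^sub>b\<^sub>-\<^sub>1\<close> if \<open>a, \<dots>, b - 1\<close> occur in w in this order,
  and 0 otherwise. In \<open>\<sigma>\<close> and \<open>\<tau>\<close> this happens exactly if \<open>[a, b - 1]\<close> is a single index or lies in an
  ascending (descending) segment, which is when the graph has an edge between a and b. For N the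
  transpose of this is applied to \<open>c\<^sub>i = -1\<close>, as \<open>f\<^sub>i\<close> has inverse \<open>I - E\<^sub>i\<^sub>+\<^sub>1\<^sub>,\<^sub>i\<close>. For B the
  matrices \<open>d\<^sub>i\<close> cancel the denominators of the \<open>e\<^sub>i\<close>, provided that the weights of odd index do not
  vanish; this holds since the solution of the Q-system is given by subtraction-free rational
  functions.\<close>

section \<open>Solutions of the Q-system do not vanish\<close>

text \<open>The field \<open>'k\<close> carries no order, so membership in \<nat> stands in for
  nonnegativity of the coefficients; in characteristic 0 such coefficients cannot cancel.\<close>

definition nat_coeffs :: "((nat \<Rightarrow>\<^sub>0 nat) \<Rightarrow>\<^sub>0 'k::field_char_0) \<Rightarrow> bool" where
  "nat_coeffs p \<longleftrightarrow> p \<noteq> 0 \<and> (\<forall>k. Poly_Mapping.lookup p k \<in> \<nat>)"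

lemma sum_in_Nats: "(\<And>x. x \<in> A \<Longrightarrow> f x \<in> \<nat>) \<Longrightarrow> (\<Sum>x\<in>A. f x) \<in> (\<nat> :: 'a::semiring_1 set)"
  by (induction A rule: infinite_finite_induct) auto

lemma Sum_any_in_Nats: "(\<And>x. f x \<in> \<nat>) \<Longrightarrow> Sum_any f \<in> (\<nat> :: 'a::semiring_1 set)"
  unfolding Sum_any.expand_set by (rule sum_in_Nats)

lemma Nats_add_eq_0D:
  fixes a b :: "'k::field_char_0"
  assumes "a \<in> \<nat>" "b \<in> \<nat>" "a + b = 0"
  shows "a = 0"
  using assms by (auto elim!: Nats_cases simp flip: of_nat_add)

lemma nat_coeffs_one: "nat_coeffs 1"
  by (simp add: nat_coeffs_def lookup_one when_def)

lemma nat_coeffs_add: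
  assumes "nat_coeffs p" "nat_coeffs q"
  shows "nat_coeffs (p + q)"
proof -
  have "p = 0" if "p + q = 0"
  proof (rule poly_mapping_eqI)
    fix k
    have "Poly_Mapping.lookup p k + Poly_Mapping.lookup q k = 0"
      using that by (metis lookup_add lookup_zero)
    then show "Poly_Mapping.lookup p k = Poly_Mapping.lookup 0 k"
      using Nats_add_eq_0D assms by (fastforce simp: nat_coeffs_def)
  qed
  with assms show ?thesis
    by (auto simp: nat_coeffs_def lookup_add)
qed

lemma nat_coeffs_mult:
  assumes "nat_coeffs p" "nat_coeffs q"
  shows "nat_coeffs (p * q)"
proof -
  have "Poly_Mapping.lookup (p * q) k \<in> \<nat>" for k
    unfolding lookup_mult using assms
    by (intro Sum_any_in_Nats Nats_mult) (auto simp: nat_coeffs_def when_def)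
  with assms show ?thesis
    by (auto simp: nat_coeffs_def)
qed

text \<open>One suitable representative is enough: the same fraction may have others with negative
  coefficients, as in (u^3 + v^3)/(u + v) = (u^2 - u v + v^2)/1.\<close>

definition subtraction_free :: "'k::field_char_0 ratfun \<Rightarrow> bool" where
  "subtraction_free x \<longleftrightarrow> (\<exists>p q. nat_coeffs p \<and> nat_coeffs q \<and> x = Fract p q)"

lemma subtraction_freeI: "nat_coeffs p \<Longrightarrow> nat_coeffs q \<Longrightarrow> subtraction_free (Fract p q)"
  unfolding subtraction_free_def by blast

lemma subtraction_freeE:
  assumes "subtraction_free x"
  obtains p q where "nat_coeffs p" "nat_coeffs q" "q \<noteq> 0" "x = Fract p q"
  using assms unfolding subtraction_free_def nat_coeffs_def by blast

lemma subtraction_free_nonzero: "subtraction_free x \<Longrightarrow> x \<noteq> 0"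
  by (auto simp: subtraction_free_def nat_coeffs_def Zero_fract_def eq_fract)

lemma subtraction_free_one: "subtraction_free 1"
  unfolding One_fract_def by (intro subtraction_freeI nat_coeffs_one)

lemma subtraction_free_indet: "subtraction_free (indet v)"
proof -
  have "nat_coeffs (Poly_Mapping.single (Poly_Mapping.single v 1) (1::'k::field_char_0))"
    by (simp add: nat_coeffs_def lookup_single when_def) (metis lookup_single_eq lookup_zero zero_neq_one)
  then show ?thesis
    unfolding indet_def by (intro subtraction_freeI nat_coeffs_one)
qed

lemma subtraction_free_add:
  assumes "subtraction_free x" "subtraction_free y"
  shows "subtraction_free (x + y)"
proof -
  obtain p q where x: "nat_coeffs p" "nat_coeffs q" "q \<noteq> 0" "x = Fract p q"
    using assms(1) by (rule subtraction_freeE)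
  obtain p' q' where y: "nat_coeffs p'" "nat_coeffs q'" "q' \<noteq> 0" "y = Fract p' q'"
    using assms(2) by (rule subtraction_freeE)
  show ?thesis
    unfolding x(4) y(4) add_fract[OF x(3) y(3)]
    by (intro subtraction_freeI nat_coeffs_add nat_coeffs_mult x(1,2) y(1,2))
qed

lemma subtraction_free_mult:
  assumes "subtraction_free x" "subtraction_free y"
  shows "subtraction_free (x * y)"
proof -
  obtain p q where x: "nat_coeffs p" "nat_coeffs q" "q \<noteq> 0" "x = Fract p q"
    using assms(1) by (rule subtraction_freeE)
  obtain p' q' where y: "nat_coeffs p'" "nat_coeffs q'" "q' \<noteq> 0" "y = Fract p' q'"
    using assms(2) by (rule subtraction_freeE)
  show ?thesis
    unfolding x(4) y(4) mult_fract
    by (intro subtraction_freeI nat_coeffs_mult x(1,2) y(1,2))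
qed

lemma subtraction_free_divide:
  assumes "subtraction_free x" "subtraction_free y"
  shows "subtraction_free (x / y)"
proof -
  obtain p q where x: "nat_coeffs p" "nat_coeffs q" "q \<noteq> 0" "x = Fract p q"
    using assms(1) by (rule subtraction_freeE)
  obtain p' q' where y: "nat_coeffs p'" "nat_coeffs q'" "q' \<noteq> 0" "y = Fract p' q'"
    using assms(2) by (rule subtraction_freeE)
  show ?thesis
    unfolding x(4) y(4) divide_fract
    by (intro subtraction_freeI nat_coeffs_mult x(1,2) y(1,2))
qed

text \<open>The recursion, solved for either outer layer, is built from addition, multiplication and
  division only. Starting from the layers 0 and 1 it reaches every integer \<open>n\<close> in both
  directions.\<close>

lemma q_system_subtraction_free:
  assumes R: "q_system r R" and "\<alpha> \<le> r + 1"
  shows "subtraction_free (R \<alpha> n)"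
proof -
  define P where "P k \<longleftrightarrow> (\<forall>\<alpha>\<le>r + 1. subtraction_free (R \<alpha> k))" for k
  have boundary: "R 0 k = 1" "R (r + 1) k = 1" for k
    using R by (auto simp: q_system_def)
  have interior: "P k" if "\<And>\<alpha>. 1 \<le> \<alpha> \<Longrightarrow> \<alpha> \<le> r \<Longrightarrow> subtraction_free (R \<alpha> k)" for k
    unfolding P_def using that boundary subtraction_free_one
    by (metis One_nat_def Suc_eq_plus1 le_Suc_eq less_one linorder_not_le)
  \<comment> \<open>Here \<open>k\<close> and \<open>k'\<close> are the two neighbours of the layer
    \<open>l\<close>, in either order, so that the same step serves upwards and downwards.\<close>
  have step: "P k" if PP: "P l" "P k'"
    and rel: "\<And>\<alpha>. 1 \<le> \<alpha> \<Longrightarrow> \<alpha> \<le> r \<Longrightarrow> R \<alpha> k * R \<alpha> k' = (R \<alpha> l)\<^sup>2 + R (\<alpha> + 1) l * R (\<alpha> - 1) l" for k k' l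
  proof (rule interior)
    fix \<alpha> assume \<alpha>: "1 \<le> \<alpha>" "\<alpha> \<le> r"
    have "subtraction_free (R \<alpha> k')" using PP \<alpha> by (simp add: P_def)
    moreover have "subtraction_free ((R \<alpha> l)\<^sup>2 + R (\<alpha> + 1) l * R (\<alpha> - 1) l)"
      unfolding power2_eq_square using PP \<alpha>
      by (intro subtraction_free_add subtraction_free_mult) (auto simp: P_def)
    moreover have "R \<alpha> k = ((R \<alpha> l)\<^sup>2 + R (\<alpha> + 1) l * R (\<alpha> - 1) l) / R \<alpha> k'"
      using rel[OF \<alpha>] subtraction_free_nonzero[OF calculation(1)] by (simp add: eq_divide_eq)
    ultimately show "subtraction_free (R \<alpha> k)"
      by (simp add: subtraction_free_divide)
  qed
  have rel: "R \<alpha> (k + 1) * R \<alpha> (k - 1) = (R \<alpha> k)\<^sup>2 + R (\<alpha> + 1) k * R (\<alpha> - 1) k"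
    if "1 \<le> \<alpha>" "\<alpha> \<le> r" for \<alpha> k
    using R that by (auto simp: q_system_def)
  have "P n \<and> P (n + 1)"
  proof (induction n rule: int_induct[where k = 0])
    case base
    have "P 0" "P 1"
      by (rule interior; use R subtraction_free_indet in \<open>auto simp: q_system_def\<close>)+
    then show ?case by simp
  next
    case (step1 i)
    then show ?case
      using step[of "i + 1" i "i + 1 + 1"] rel[of _ "i + 1"] by simp
  next
    case (step2 i)
    then show ?case
      using step[of i "i + 1" "i - 1"] rel[of _ i] by (simp add: mult.commute)
  qed
  with \<open>\<alpha> \<le> r + 1\<close> show ?thesis by (simp add: P_def)
qed

lemma q_system_nonzero: "q_system r R \<Longrightarrow> \<alpha> \<le> r + 1 \<Longrightarrow> R \<alpha> n \<noteq> 0"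
  by (intro subtraction_free_nonzero q_system_subtraction_free)

lemma weight_y_odd_nonzero:
  assumes "q_system r R" "1 \<le> i" "i \<le> r + 1"
  shows "weight_y R m (2 * i - 1) \<noteq> 0"
proof -
  have "(2 * i - 1 + 1) div 2 = i" "odd (2 * i - 1)" "i - 1 \<le> r + 1"
    using assms by auto
  then show ?thesis
    using q_system_nonzero[OF assms(1)] assms by (simp add: weight_y_def Let_def lam_def)
qed


section \<open>Segments\<close>

text \<open>The condition becomes local, one equation for each pair of neighbours, so that
  restricting and joining segments is immediate.\<close>

lemma segment_iff_steps:
  "segment r m s \<alpha> \<beta> \<longleftrightarrow>
     1 \<le> \<alpha> \<and> \<alpha> < \<beta> \<and> \<beta> \<le> r \<and> (\<forall>i. \<alpha> \<le> i \<and> i < \<beta> \<longrightarrow> m (i + 1) = m i + s)"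
  (is "?L \<longleftrightarrow> ?R")
proof
  assume L: ?L
  then have *: "m (\<alpha> + j) = m \<alpha> + s * int j" if "j \<le> \<beta> - \<alpha>" for j
    using that by (auto simp: segment_def)
  have "m (i + 1) = m i + s" if "\<alpha> \<le> i" "i < \<beta>" for i
  proof -
    have "i - \<alpha> \<le> \<beta> - \<alpha>" "i - \<alpha> + 1 \<le> \<beta> - \<alpha>" using that by linarith+
    then show ?thesis
      using *[of "i - \<alpha>"] *[of "i - \<alpha> + 1"] that by (simp add: algebra_simps)
  qed
  with L show ?R by (auto simp: segment_def)
next
  assume R: ?R
  have "j \<le> \<beta> - \<alpha> \<longrightarrow> m (\<alpha> + j) = m \<alpha> + s * int j" for j
  proof (induction j)
    case (Suc j)
    have "m (\<alpha> + j + 1) = m (\<alpha> + j) + s" if "Suc j \<le> \<beta> - \<alpha>"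
      using R that by auto
    with Suc show ?case by (auto simp: algebra_simps)
  qed simp
  with R show ?L by (auto simp: segment_def)
qed

lemma segment_mono:
  "segment r m s \<alpha> \<beta> \<Longrightarrow> \<alpha> \<le> \<alpha>' \<Longrightarrow> \<alpha>' < \<beta>' \<Longrightarrow> \<beta>' \<le> \<beta> \<Longrightarrow> segment r m s \<alpha>' \<beta>'"
  by (auto simp: segment_iff_steps)

text \<open>One common index \<open>v\<close> suffices: each step of the union lies on one side of
  \<open>v\<close>, hence in one of the two segments.\<close>

lemma segment_Un:
  assumes "segment r m s \<alpha> \<beta>" "segment r m s \<alpha>' \<beta>'" "\<alpha> \<le> v" "v \<le> \<beta>" "\<alpha>' \<le> v" "v \<le> \<beta>'"
  shows "segment r m s (min \<alpha> \<alpha>') (max \<beta> \<beta>')"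
proof -
  have "m (i + 1) = m i + s" if "min \<alpha> \<alpha>' \<le> i" "i < max \<beta> \<beta>'" for i
  proof -
    have "\<alpha> \<le> i \<and> i < \<beta> \<or> \<alpha>' \<le> i \<and> i < \<beta>'" using assms(3-6) that by linarith
    with assms(1,2) show ?thesis by (auto simp: segment_iff_steps)
  qed
  moreover have "1 \<le> min \<alpha> \<alpha>'" "min \<alpha> \<alpha>' < max \<beta> \<beta>'" "max \<beta> \<beta>' \<le> r"
    using assms by (auto simp: segment_def)
  ultimately show ?thesis by (simp add: segment_iff_steps)
qed

lemma max_segment_unique:
  assumes "max_segment r m s \<alpha> \<beta>" "max_segment r m s \<alpha>' \<beta>'"
    and "\<alpha> \<le> v" "v \<le> \<beta>" "\<alpha>' \<le> v" "v \<le> \<beta>'"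
  shows "\<alpha> = \<alpha>' \<and> \<beta> = \<beta>'"
proof -
  let ?a = "min \<alpha> \<alpha>'" and ?b = "max \<beta> \<beta>'"
  have "segment r m s ?a ?b"
    using assms by (intro segment_Un) (auto simp: max_segment_def)
  then have "\<not> {\<alpha>..\<beta>} \<subset> {?a..?b}" "\<not> {\<alpha>'..\<beta>'} \<subset> {?a..?b}"
    using assms by (auto simp: max_segment_def)
  moreover have "{\<alpha>..\<beta>} \<subseteq> {?a..?b}" "{\<alpha>'..\<beta>'} \<subseteq> {?a..?b}" by auto
  ultimately have "{\<alpha>..\<beta>} = {?a..?b}" "{\<alpha>'..\<beta>'} = {?a..?b}"
    by (metis psubsetI)+
  with assms show ?thesis by (auto simp: Icc_eq_Icc)
qed

section \<open>Extension of segments to maximal ones\<close>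

lemma finite_has_arg_max:
  fixes f :: "'a \<Rightarrow> nat"
  assumes "finite S" "S \<noteq> {}"
  shows "\<exists>x\<in>S. \<forall>z\<in>S. f z \<le> f x"
proof -
  have "Max (f ` S) \<in> f ` S" using assms by (intro Max_in) auto
  then obtain x where x: "x \<in> S" "f x = Max (f ` S)" by auto
  then show ?thesis using assms by (metis Max_ge finite_imageI imageI)
qed

text \<open>Among the finitely many segments containing the given one, a longest is maximal.\<close>

lemma segment_extend:
  assumes "segment r m s \<alpha> \<beta>"
  obtains \<alpha>' \<beta>' where "max_segment r m s \<alpha>' \<beta>'" "\<alpha>' \<le> \<alpha>" "\<beta> \<le> \<beta>'"
proof -
  define S where "S = {(a, b). segment r m s a b \<and> a \<le> \<alpha> \<and> \<beta> \<le> b}"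
  have "S \<subseteq> {..r} \<times> {..r}" by (auto simp: S_def segment_def)
  then have "finite S" by (rule finite_subset) auto
  moreover have "S \<noteq> {}" using assms by (auto simp: S_def)
  ultimately obtain x where x: "x \<in> S" "\<And>z. z \<in> S \<Longrightarrow> snd z - fst z \<le> snd x - fst x"
    using finite_has_arg_max[of S "\<lambda>z. snd z - fst z"] by blast
  obtain a b where ab: "x = (a, b)" by fastforce
  have "max_segment r m s a b"
    unfolding max_segment_def
  proof (intro conjI notI; (elim exE conjE)?)
    show "segment r m s a b" using x ab by (auto simp: S_def)
    fix a' b' assume *: "segment r m s a' b'" "{a..b} \<subset> {a'..b'}"
    \<comment> \<open>Both intervals are nonempty, so that strict inclusion can be read off from the
      endpoints and yields a greater length.\<close>
    have "a < b" "a' < b'"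
      using x ab * by (auto simp: S_def segment_def)
    with * have "a' \<le> a" "b \<le> b'" "b - a < b' - a'" by auto
    with x(2)[of "(a', b')"] x(1) ab * show False by (auto simp: S_def)
  qed
  with x(1) ab that show ?thesis by (auto simp: S_def)
qed


section \<open>The words \<open>\<sigma>\<close> and \<open>\<tau>\<close>\<close>

text \<open>Applied to the position of a letter in the word, a block reversal is a reflection. Hence
  \<open>\<sigma>\<close> and \<open>\<tau>\<close> are the images of \<open>(r, \<dots>, 1)\<close> under an involution of the letters, and the letter v
  occurs at the position where \<open>(r, \<dots>, 1)\<close> has the image of v.\<close>

definition reflect :: "nat \<times> nat \<Rightarrow> nat \<Rightarrow> nat" where
  "reflect = (\<lambda>(\<alpha>, \<beta>) v. if \<alpha> \<le> v \<and> v \<le> \<beta> then \<alpha> + \<beta> - v else v)"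

text \<open>Position \<open>p\<close> of (r, ..., 1) holds \<open>r - p\<close>, so reversing a
  range of positions precomposes with a reflection. The function \<open>h\<close> is arbitrary
  because later blocks act on words that are already rearranged.\<close>

lemma reverse_block_map:
  assumes "1 \<le> \<alpha>" "\<alpha> \<le> \<beta>" "\<beta> \<le> r"
  shows "reverse_block r (\<alpha>, \<beta>) (map h (rev [1..<r + 1])) =
         map (h \<circ> reflect (\<alpha>, \<beta>)) (rev [1..<r + 1])"
proof (rule nth_equalityI)
  show "length (reverse_block r (\<alpha>, \<beta>) (map h (rev [1..<r + 1]))) =
        length (map (h \<circ> reflect (\<alpha>, \<beta>)) (rev [1..<r + 1]))"
    using assms by (simp add: reverse_block_def)
  fix p assume "p < length (reverse_block r (\<alpha>, \<beta>) (map h (rev [1..<r + 1])))"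
  then have p: "p < r" using assms by (simp add: reverse_block_def)
  have nth: "map h' (rev [1..<r + 1]) ! q = h' (r - q)" if "q < r" for q and h' :: "nat \<Rightarrow> 'a"
    using that by (simp add: rev_nth Suc_diff_Suc del: upt_Suc)
  consider "p < r - \<beta>" | "r - \<beta> \<le> p" "p \<le> r - \<alpha>" | "r - \<alpha> < p" by linarith
  then show "reverse_block r (\<alpha>, \<beta>) (map h (rev [1..<r + 1])) ! p =
        map (h \<circ> reflect (\<alpha>, \<beta>)) (rev [1..<r + 1]) ! p"
    unfolding nth[OF p]
  proof cases
    case 1
    then show "reverse_block r (\<alpha>, \<beta>) (map h (rev [1..<r + 1])) ! p = (h \<circ> reflect (\<alpha>, \<beta>)) (r - p)"
      using assms p nth[of p h] by (auto simp: reverse_block_def nth_append reflect_def simp del: upt_Suc)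
  next
    case 2
    \<comment> \<open>Writing all quantities as sums avoids truncated subtraction: \<open>p\<close>
      is the place \<open>j\<close> inside the block of \<open>l + 1\<close> positions starting at
      \<open>k\<close>, and its mirror image is \<open>k + j'\<close>.\<close>
    obtain k l where r: "r = \<alpha> + l + k" and \<beta>: "\<beta> = \<alpha> + l"
      using assms by (metis le_iff_add)
    obtain j j' where l: "l = j + j'" and j: "p = k + j"
      using 2 unfolding r \<beta> by (metis add_diff_cancel_left' add_diff_cancel_right' add.commute
        add.assoc le_iff_add add_le_cancel_left)
    have "reverse_block r (\<alpha>, \<beta>) (map h (rev [1..<r + 1])) ! p =
          map h (rev [1..<r + 1]) ! (k + j')"
      unfolding reverse_block_def r \<beta> l j using assms(1)
      by (simp add: nth_append rev_nth del: upt_Suc)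
    also have "\<dots> = h (r - (k + j'))"
      using assms(1) by (intro nth) (simp add: r l)
    finally show "reverse_block r (\<alpha>, \<beta>) (map h (rev [1..<r + 1])) ! p = (h \<circ> reflect (\<alpha>, \<beta>)) (r - p)"
      by (simp add: reflect_def r \<beta> l j)
  next
    case 3
    then show "reverse_block r (\<alpha>, \<beta>) (map h (rev [1..<r + 1])) ! p = (h \<circ> reflect (\<alpha>, \<beta>)) (r - p)"
      using assms p nth[of p h] by (auto simp: reverse_block_def nth_append reflect_def simp del: upt_Suc)
  qed
qed

text \<open>Every further block is composed on the right, so the last block of the list acts on a
  letter first; this is why the inductions below peel blocks off the end.\<close>

definition reflect_all :: "(nat \<times> nat) list \<Rightarrow> nat \<Rightarrow> nat" where
  "reflect_all bs = fold (\<lambda>b h. h \<circ> reflect b) bs id"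

lemma fold_reverse_block_map:
  assumes "\<forall>(\<alpha>, \<beta>) \<in> set bs. 1 \<le> \<alpha> \<and> \<alpha> \<le> \<beta> \<and> \<beta> \<le> r"
  shows "fold (reverse_block r) bs (map h (rev [1..<r + 1])) =
         map (fold (\<lambda>b h. h \<circ> reflect b) bs h) (rev [1..<r + 1])"
  using assms
proof (induction bs arbitrary: h)
  case (Cons b bs)
  obtain \<alpha> \<beta> where b: "b = (\<alpha>, \<beta>)" by fastforce
  with Cons.prems have *: "1 \<le> \<alpha>" "\<alpha> \<le> \<beta>" "\<beta> \<le> r"
    "\<forall>(\<alpha>, \<beta>) \<in> set bs. 1 \<le> \<alpha> \<and> \<alpha> \<le> \<beta> \<and> \<beta> \<le> r"
    by auto
  show ?case
    by (simp only: fold_simps b reverse_block_map[OF *(1-3)] Cons.IH[OF *(4)])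
qed simp

lemma reflect_all_snoc: "reflect_all (bs @ [b]) v = reflect_all bs (reflect b v)"
  by (simp add: reflect_all_def)

lemma reflect_all_outside:
  assumes "\<forall>(\<alpha>, \<beta>) \<in> set bs. \<not> (\<alpha> \<le> v \<and> v \<le> \<beta>)"
  shows "reflect_all bs v = v"
  using assms
proof (induction bs rule: rev_induct)
  case (snoc b bs)
  then show ?case by (auto simp: reflect_all_snoc reflect_def split: prod.splits)
qed (simp add: reflect_all_def)

text \<open>Only the block containing \<open>v\<close> moves it, and the image stays in that block,
  where no other block acts. Distinctness ensures that the reflection is applied just once.\<close>

lemma reflect_all_inside:
  assumes "distinct bs" "(\<alpha>, \<beta>) \<in> set bs" "\<alpha> \<le> v" "v \<le> \<beta>"
    and "\<forall>(\<alpha>', \<beta>') \<in> set bs. \<forall>u. \<alpha> \<le> u \<and> u \<le> \<beta> \<and> \<alpha>' \<le> u \<and> u \<le> \<beta>' \<longrightarrow> \<alpha> = \<alpha>' \<and> \<beta> = \<beta>'"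
  shows "reflect_all bs v = \<alpha> + \<beta> - v"
  using assms
proof (induction bs rule: rev_induct)
  case (snoc b bs)
  show ?case
  proof (cases "b = (\<alpha>, \<beta>)")
    case True
    have "reflect_all bs (\<alpha> + \<beta> - v) = \<alpha> + \<beta> - v"
    proof (rule reflect_all_outside, safe)
      fix \<alpha>' \<beta>'
      assume *: "(\<alpha>', \<beta>') \<in> set bs" "\<alpha>' \<le> \<alpha> + \<beta> - v" "\<alpha> + \<beta> - v \<le> \<beta>'"
      then have "(\<alpha>', \<beta>') = (\<alpha>, \<beta>)"
        using snoc.prems(3-5) by force
      with * True snoc.prems(1) show False by auto
    qed
    with True snoc.prems show ?thesis by (simp add: reflect_all_snoc reflect_def)
  next
    case False
    then have "reflect b v = v"
    proof (cases b)
      case (Pair \<alpha>' \<beta>')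
      then show ?thesis
        using snoc.prems(3,4) snoc.prems(5)[rule_format, of b] False by (auto simp: reflect_def)
    qed
    with False snoc show ?thesis by (auto simp: reflect_all_snoc)
  qed
qed simp

lemma set_max_segments: "(\<alpha>, \<beta>) \<in> set (max_segments r m s) \<longleftrightarrow> max_segment r m s \<alpha> \<beta>"
  by (auto simp: max_segments_def max_segment_def segment_def)

lemma distinct_max_segments: "distinct (max_segments r m s)"
  by (auto simp: max_segments_def intro!: distinct_filter distinct_product)

definition segment_reflection :: "nat \<Rightarrow> (nat \<Rightarrow> int) \<Rightarrow> int \<Rightarrow> nat \<Rightarrow> nat" where
  "segment_reflection r m s = reflect_all (max_segments r m s)"

lemma segment_reflection_inside:
  assumes "max_segment r m s \<alpha> \<beta>" "\<alpha> \<le> v" "v \<le> \<beta>"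
  shows "segment_reflection r m s v = \<alpha> + \<beta> - v"
  unfolding segment_reflection_def
proof (rule reflect_all_inside)
  show "\<forall>(\<alpha>', \<beta>') \<in> set (max_segments r m s).
      \<forall>u. \<alpha> \<le> u \<and> u \<le> \<beta> \<and> \<alpha>' \<le> u \<and> u \<le> \<beta>' \<longrightarrow> \<alpha> = \<alpha>' \<and> \<beta> = \<beta>'"
    using max_segment_unique[OF assms(1)] by (auto simp: set_max_segments)
qed (use assms in \<open>auto simp: set_max_segments distinct_max_segments\<close>)

lemma segment_reflection_outside:
  assumes "\<And>\<alpha> \<beta>. max_segment r m s \<alpha> \<beta> \<Longrightarrow> \<not> (\<alpha> \<le> v \<and> v \<le> \<beta>)"
  shows "segment_reflection r m s v = v"
  unfolding segment_reflection_def
  by (rule reflect_all_outside) (use assms in \<open>auto simp: set_max_segments\<close>)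

lemma segment_reflection_cases:
  obtains (inside) \<alpha> \<beta> where "max_segment r m s \<alpha> \<beta>" "\<alpha> \<le> v" "v \<le> \<beta>"
    "segment_reflection r m s v = \<alpha> + \<beta> - v"
  | (outside) "\<And>\<alpha> \<beta>. max_segment r m s \<alpha> \<beta> \<Longrightarrow> \<not> (\<alpha> \<le> v \<and> v \<le> \<beta>)"
    "segment_reflection r m s v = v"
  using segment_reflection_inside segment_reflection_outside by metis

lemma segment_reflection_involution:
  "segment_reflection r m s (segment_reflection r m s v) = v"
proof (cases v rule: segment_reflection_cases[of r m s])
  case (inside \<alpha> \<beta>)
  then show ?thesis
    using segment_reflection_inside[of r m s \<alpha> \<beta> "\<alpha> + \<beta> - v"] by auto
qed simp

lemma segment_reflection_range:
  "1 \<le> v \<Longrightarrow> v \<le> r \<Longrightarrow> segment_reflection r m s v \<in> {1..r}"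
  by (cases v rule: segment_reflection_cases[of r m s]) (auto simp: max_segment_def segment_def)

text \<open>Inside a maximal segment the reflection reverses order. Across a boundary it preserves
  order, because images stay in their own, disjoint blocks.\<close>

lemma segment_reflection_descent:
  "segment_reflection r m s (v + 1) < segment_reflection r m s v \<longleftrightarrow> segment r m s v (v + 1)"
proof
  assume "segment r m s v (v + 1)"
  then obtain \<alpha> \<beta> where "max_segment r m s \<alpha> \<beta>" "\<alpha> \<le> v" "v + 1 \<le> \<beta>"
    by (rule segment_extend)
  then show "segment_reflection r m s (v + 1) < segment_reflection r m s v"
    by (simp add: segment_reflection_inside)
next
  assume *: "segment_reflection r m s (v + 1) < segment_reflection r m s v"
  show "segment r m s v (v + 1)"
  proof (cases v rule: segment_reflection_cases[of r m s])
    case v: (inside \<alpha> \<beta>)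
    show ?thesis
    proof (cases "v + 1 \<le> \<beta>")
      case True
      with v show ?thesis by (auto simp: max_segment_def intro: segment_mono)
    next
      case False
      \<comment> \<open>The image of the endpoint \<open>v\<close> is \<alpha>. A descent would
        force a block around \<open>v + 1\<close> to reach down to \<open>v\<close>, hence to be the
        same block, which ends at \<open>v\<close>.\<close>
      with v have "v = \<beta>" by simp
      with v * have "segment_reflection r m s (v + 1) < \<alpha>" "\<alpha> \<le> v" by auto
      then show ?thesis
      proof (cases "v + 1" rule: segment_reflection_cases[of r m s])
        case (inside \<alpha>' \<beta>')
        with \<open>segment_reflection r m s (v + 1) < \<alpha>\<close> \<open>\<alpha> \<le> v\<close> have "\<alpha>' \<le> v" "v \<le> \<beta>'" by auto
        with v inside max_segment_unique[of r m s \<alpha> \<beta> \<alpha>' \<beta>' v] False show ?thesis by auto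
      qed auto
    qed
  next
    case v: outside
    show ?thesis
    proof (cases "v + 1" rule: segment_reflection_cases[of r m s])
      case (inside \<alpha> \<beta>)
      have "\<alpha> \<le> v" "v \<le> \<beta>" using inside(3,4) v(2) * by linarith+
      with v inside show ?thesis by blast
    qed (use v * in auto)
  qed
qed

text \<open>The slope is kept as a parameter so that \<open>sigma_seq\<close> (slope 1) and
  \<open>tau_seq\<close> (slope -1) are treated together.\<close>

definition segment_word :: "nat \<Rightarrow> (nat \<Rightarrow> int) \<Rightarrow> int \<Rightarrow> nat list" where
  "segment_word r m s = fold (reverse_block r) (max_segments r m s) (rev [1..<r + 1])"

lemma segment_word_eq_map:
  "segment_word r m s = map (segment_reflection r m s) (rev [1..<r + 1])"
proof -
  have "\<forall>(\<alpha>, \<beta>) \<in> set (max_segments r m s). 1 \<le> \<alpha> \<and> \<alpha> \<le> \<beta> \<and> \<beta> \<le> r"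
    by (auto simp: set_max_segments max_segment_def segment_def)
  from fold_reverse_block_map[OF this, of id] show ?thesis
    by (simp add: segment_word_def segment_reflection_def reflect_all_def del: upt_Suc)
qed

lemma distinct_segment_word: "distinct (segment_word r m s)"
  unfolding segment_word_eq_map distinct_map
  by (auto simp del: upt_Suc intro!: inj_onI) (metis segment_reflection_involution)

lemma set_segment_word: "set (segment_word r m s) = {1..r}"
proof -
  have "segment_reflection r m s ` {1..r} = {1..r}"
    using segment_reflection_range[of _ r m s] segment_reflection_involution[of r m s]
    by (auto simp del: atLeastAtMost_iff simp: image_iff) (metis atLeastAtMost_iff)+
  then show ?thesis
    by (simp add: segment_word_eq_map atLeastLessThanSuc_atLeastAtMost del: upt_Suc)
qed

section \<open>Runs of consecutive letters occurring in order\<close>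

lemma subseq_rev_upt_iff:
  "subseq xs (rev [1..<n + 1]) \<longleftrightarrow> sorted_wrt (>) xs \<and> set xs \<subseteq> {1..n}"
proof (induction n arbitrary: xs)
  case 0
  show ?case by (cases xs) auto
next
  case (Suc n)
  show ?case
  proof (cases xs)
    case (Cons x ys)
    show ?thesis
    proof (cases "x = Suc n")
      case True
      have "y < Suc n \<longleftrightarrow> y \<le> n" for y by auto
      then have "sorted_wrt (>) xs \<and> set xs \<subseteq> {1..Suc n} \<longleftrightarrow> sorted_wrt (>) ys \<and> set ys \<subseteq> {1..n}"
        using Cons True by auto
      then show ?thesis using Cons True Suc[of ys] by simp
    next
      case False
      then have "sorted_wrt (>) xs \<Longrightarrow> set xs \<subseteq> {1..Suc n} \<Longrightarrow> set xs \<subseteq> {1..n}"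
        using Cons by fastforce
      moreover have "subseq xs (rev [1..<Suc n + 1]) \<longleftrightarrow> subseq xs (rev [1..<n + 1])"
        using Cons False by simp
      ultimately show ?thesis using Suc[of xs] by auto
    qed
  qed simp
qed

lemma subseq_map_involution_iff:
  assumes "\<And>v. g (g v) = v"
  shows "subseq xs (map g ys) \<longleftrightarrow> subseq (map g xs) ys"
proof -
  have "map g (map g zs) = zs" for zs using assms by (simp add: map_idI)
  then show ?thesis by (metis subseq_map)
qed

text \<open>The letters occur in order iff their images under the reflection decrease, which is
  tested on neighbouring letters. The case \<open>b = a + 1\<close> is separate since a segment has
  at least two indices; \<open>b\<close> itself is a vertex, not a letter, and may be
  \<open>r + 1\<close>.\<close>

lemma subseq_segment_word_iff:
  assumes "1 \<le> a" "a < b" "b \<le> r + 1"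
  shows "subseq [a..<b] (segment_word r m s) \<longleftrightarrow> b = a + 1 \<or> segment r m s a (b - 1)"
proof -
  let ?g = "segment_reflection r m s"
  have "subseq [a..<b] (segment_word r m s) \<longleftrightarrow> subseq (map ?g [a..<b]) (rev [1..<r + 1])"
    unfolding segment_word_eq_map
    by (rule subseq_map_involution_iff) (rule segment_reflection_involution)
  also have "\<dots> \<longleftrightarrow> sorted_wrt (>) (map ?g [a..<b])"
    unfolding subseq_rev_upt_iff using assms segment_reflection_range[of _ r m s] by fastforce
  also have "\<dots> \<longleftrightarrow> (\<forall>i. Suc i < b - a \<longrightarrow> ?g (a + i + 1) < ?g (a + i))"
    by (subst sorted_wrt_iff_nth_Suc_transp) (auto simp: transp_def)
  also have "\<dots> \<longleftrightarrow> (\<forall>i. Suc i < b - a \<longrightarrow> segment r m s (a + i) (a + i + 1))"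
    by (simp only: segment_reflection_descent)
  also have "\<dots> \<longleftrightarrow> b = a + 1 \<or> segment r m s a (b - 1)"
  proof -
    have "(\<forall>i. Suc i < b - a \<longrightarrow> segment r m s (a + i) (a + i + 1)) \<longleftrightarrow>
          (\<forall>i. a \<le> i \<and> i < b - 1 \<longrightarrow> segment r m s i (i + 1))"
      (is "?L \<longleftrightarrow> ?R")
    proof
      assume L: ?L
      show ?R
      proof (intro allI impI)
        fix i assume "a \<le> i \<and> i < b - 1"
        then show "segment r m s i (i + 1)" using L[rule_format, of "i - a"] by fastforce
      qed
    qed auto
    also have "\<dots> \<longleftrightarrow> b = a + 1 \<or> segment r m s a (b - 1)"
      using assms by (auto simp: segment_iff_steps)
    finally show ?thesis .
  qed
  finally show ?thesis .
qed


section \<open>Products of elementary matrices\<close>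

lemma mat_prod_Nil: "mat_prod r [] = 1\<^sub>m (r + 1)"
  by (simp add: mat_prod_def)

lemma mat_prod_Cons: "mat_prod r (A # As) = A * mat_prod r As"
  by (simp add: mat_prod_def)

lemma mat_prod_carrier:
  "(\<And>A. A \<in> set As \<Longrightarrow> A \<in> carrier_mat (r + 1) (r + 1)) \<Longrightarrow> mat_prod r As \<in> carrier_mat (r + 1) (r + 1)"
  by (induction As) (auto simp: mat_prod_Nil mat_prod_Cons intro!: mult_carrier_mat)

lemma mat_unit_carrier: "mat_unit r i j \<in> carrier_mat (r + 1) (r + 1)"
  by (simp add: mat_unit_def)

text \<open>Left multiplication is a row operation. It covers all the elementary matrices, with
  \<open>i = j\<close> for the diagonal ones.\<close>

lemma index_add_mat_unit_mult:
  assumes M: "M \<in> carrier_mat (r + 1) (r + 1)" and ab: "a \<le> r" "b \<le> r" and j: "1 \<le> j" "j \<le> r + 1"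
  shows "((1\<^sub>m (r + 1) + c \<cdot>\<^sub>m mat_unit r i j) * M) $$ (a, b) =
         M $$ (a, b) + (if a + 1 = i then c * M $$ (j - 1, b) else 0)"
proof -
  have "(mat_unit r i j * M) $$ (a, b) =
        (\<Sum>l = 0..<r + 1. (if a + 1 = i \<and> l + 1 = j then 1 else 0) * M $$ (l, b))"
    using M ab by (simp add: mat_unit_def scalar_prod_def)
  also have "\<dots> = (\<Sum>l = 0..<r + 1. if l = j - 1 then (if a + 1 = i then M $$ (l, b) else 0) else 0)"
    using j by (intro sum.cong) auto
  also have "\<dots> = (if a + 1 = i then M $$ (j - 1, b) else 0)"
    using j by (subst sum.delta) auto
  finally have *: "(mat_unit r i j * M) $$ (a, b) = (if a + 1 = i then M $$ (j - 1, b) else 0)" .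
  have "(1\<^sub>m (r + 1) + c \<cdot>\<^sub>m mat_unit r i j) * M = M + c \<cdot>\<^sub>m (mat_unit r i j * M)"
    by (simp only: add_mult_distrib_mat[OF one_carrier_mat smult_carrier_mat[OF mat_unit_carrier] M]
        mult_smult_assoc_mat[OF mat_unit_carrier M] left_mult_one_mat[OF M])
  then show ?thesis
    using ab * carrier_matD[OF M] by (simp add: carrier_matD[OF mat_unit_carrier])
qed

text \<open>With \<open>c i = y (2 * i) / y (2 * i - 1)\<close> this is \<open>elem_e\<close>; with
  \<open>c i = -1\<close> it is the transpose of the inverse of \<open>elem_f\<close>.\<close>

definition upper_unit :: "nat \<Rightarrow> (nat \<Rightarrow> 'a::field) \<Rightarrow> nat \<Rightarrow> 'a mat" where
  "upper_unit r c i = 1\<^sub>m (r + 1) + c i \<cdot>\<^sub>m mat_unit r i (i + 1)"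

lemma upper_unit_carrier: "upper_unit r c i \<in> carrier_mat (r + 1) (r + 1)"
  unfolding upper_unit_def by (intro add_carrier_mat smult_carrier_mat mat_unit_carrier)

lemma elem_f_carrier: "elem_f r i \<in> carrier_mat (r + 1) (r + 1)"
  unfolding elem_f_def by (intro add_carrier_mat smult_carrier_mat mat_unit_carrier)

lemma elem_d_carrier: "elem_d r y i \<in> carrier_mat (r + 1) (r + 1)"
  unfolding elem_d_def by (intro add_carrier_mat smult_carrier_mat mat_unit_carrier)

lemma mat_prod_upper_unit_carrier:
  "mat_prod r (map (upper_unit r c) w) \<in> carrier_mat (r + 1) (r + 1)"
  by (rule mat_prod_carrier) (auto simp: upper_unit_carrier[simplified])

text \<open>A new first letter \<open>k\<close> adds \<open>c k\<close> times row
  \<open>k + 1\<close> to row \<open>k\<close>. The row \<open>a\<close> is generalized in the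
  induction because both rows are needed.\<close>

lemma index_mat_prod_upper_unit:
  assumes "distinct w" "set w \<subseteq> {1..r}" "a \<le> r" "b \<le> r"
  shows "mat_prod r (map (upper_unit r c) w) $$ (a, b) =
         (if a \<le> b \<and> subseq [a + 1..<b + 1] w then \<Prod>j = a + 1..<b + 1. c j else 0)"
  using assms
proof (induction w arbitrary: a)
  case Nil
  then show ?case by (auto simp: mat_prod_Nil)
next
  case (Cons k w)
  let ?M = "mat_prod r (map (upper_unit r c) w)"
  have IH: "?M $$ (a', b) =
      (if a' \<le> b \<and> subseq [a' + 1..<b + 1] w then \<Prod>j = a' + 1..<b + 1. c j else 0)" if "a' \<le> r" for a'
    using Cons that by auto
  have k: "1 \<le> k" "k \<le> r" "k \<notin> set w" using Cons.prems by auto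
  have eq: "mat_prod r (map (upper_unit r c) (k # w)) $$ (a, b) =
        ?M $$ (a, b) + (if a + 1 = k then c k * ?M $$ (k, b) else 0)"
    using index_add_mat_unit_mult[OF mat_prod_upper_unit_carrier, of a r b "k + 1" "c k" k c w] Cons.prems k
    by (simp add: mat_prod_Cons upper_unit_def)
  show ?case
  proof (cases "a + 1 = k")
    case False
    have "subseq [a + 1..<b + 1] (k # w) \<longleftrightarrow> subseq [a + 1..<b + 1] w"
      using False by (cases "a < b") (simp_all add: upt_conv_Cons del: upt_Suc)
    with False show ?thesis by (simp only: eq IH[OF Cons.prems(3)]) simp
  next
    case True
    \<comment> \<open>As \<open>k\<close> does not occur in \<open>w\<close>, the old row
      contributes nothing off the diagonal, and only the added row remains.\<close>
    have nosub: "\<not> subseq [a + 1..<b + 1] w" if "a < b"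
    proof
      assume "subseq [a + 1..<b + 1] w"
      moreover have "k \<in> set [a + 1..<b + 1]" using True that by auto
      ultimately show False using k(3) by (auto elim: list_emb_set simp del: upt_Suc)
    qed
    show ?thesis
    proof (cases "a < b")
      case lt: True
      have "[a + 1..<b + 1] = k # [k + 1..<b + 1]"
        using lt True by (simp add: upt_conv_Cons del: upt_Suc)
      moreover have "(\<Prod>j = a + 1..<b + 1. c j) = c k * (\<Prod>j = k + 1..<b + 1. c j)"
        using lt True by (subst prod.atLeast_Suc_lessThan) auto
      ultimately show ?thesis
        unfolding eq IH[OF Cons.prems(3)] IH[OF k(2)] using nosub lt True by (simp del: upt_Suc)
    next
      case False
      then show ?thesis
        unfolding eq IH[OF Cons.prems(3)] IH[OF k(2)] using True by auto
    qed
  qed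
qed

lemma elem_f_inverse:
  assumes "1 \<le> k" "k \<le> r"
  shows "elem_f r k * (upper_unit r (\<lambda>_. -1) k)\<^sup>T = (1\<^sub>m (r + 1) :: 'a::field mat)"
proof (rule eq_matI)
  fix a b assume "a < dim_row (1\<^sub>m (r + 1) :: 'a mat)" "b < dim_col (1\<^sub>m (r + 1) :: 'a mat)"
  then have ab: "a \<le> r" "b \<le> r" by auto
  let ?M = "(upper_unit r (\<lambda>_. -1) k)\<^sup>T :: 'a mat"
  have M: "?M \<in> carrier_mat (r + 1) (r + 1)"
    using upper_unit_carrier by (simp only: transpose_carrier_mat)
  have ent: "?M $$ (i, j) = (if i = j then 1 else if i = k \<and> j + 1 = k then -1 else 0)"
    if "i \<le> r" "j \<le> r" for i j
    using that by (auto simp: upper_unit_def mat_unit_def)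
  have "(elem_f r k * ?M) $$ (a, b) = ?M $$ (a, b) + (if a + 1 = k + 1 then ?M $$ (k - 1, b) else 0)"
  proof -
    \<comment> \<open>A trivial scalar factor brings \<open>elem_f\<close> into the shape of the row
      operation.\<close>
    have "(elem_f r k :: 'a mat) = 1\<^sub>m (r + 1) + 1 \<cdot>\<^sub>m mat_unit r (k + 1) k"
      unfolding elem_f_def by (rule eq_matI) (auto simp: mat_unit_def)
    then show ?thesis
      using index_add_mat_unit_mult[OF M ab, of k 1 "k + 1"] assms by simp
  qed
  then show "(elem_f r k * ?M) $$ (a, b) = 1\<^sub>m (r + 1) $$ (a, b)"
    using ab assms by (auto simp: ent)
qed (use elem_f_carrier[of r k] upper_unit_carrier[of r _ k] in auto)

text \<open>Inversion and transposition both reverse a product, so the same word \<open>w\<close>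
  appears in both factors.\<close>

lemma mat_prod_elem_f_inverse:
  assumes "set w \<subseteq> {1..r}"
  shows "mat_prod r (map (elem_f r) w) * (mat_prod r (map (upper_unit r (\<lambda>_. -1)) w))\<^sup>T =
         (1\<^sub>m (r + 1) :: 'a::field mat)"
  using assms
proof (induction w)
  case Nil
  then show ?case by (simp add: mat_prod_Nil)
next
  case (Cons k w)
  let ?n = "r + 1"
  let ?F = "mat_prod r (map (elem_f r) w) :: 'a mat" and ?f = "elem_f r k :: 'a mat"
    and ?Q = "mat_prod r (map (upper_unit r (\<lambda>_. -1)) w) :: 'a mat"
    and ?u = "upper_unit r (\<lambda>_. -1) k :: 'a mat"
  have F: "?F \<in> carrier_mat ?n ?n"
    by (rule mat_prod_carrier) (use elem_f_carrier in auto)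
  have f: "?f \<in> carrier_mat ?n ?n" and u: "?u \<in> carrier_mat ?n ?n" and Q: "?Q \<in> carrier_mat ?n ?n"
    by (rule elem_f_carrier upper_unit_carrier mat_prod_upper_unit_carrier)+
  have ut: "?u\<^sup>T \<in> carrier_mat ?n ?n" and Qt: "?Q\<^sup>T \<in> carrier_mat ?n ?n"
    by (simp_all only: transpose_carrier_mat u Q)
  have "?f * ?F * (?u * ?Q)\<^sup>T = ?f * ?F * (?Q\<^sup>T * ?u\<^sup>T)"
    by (simp only: transpose_mult[OF u Q])
  also have "\<dots> = ?f * (?F * (?Q\<^sup>T * ?u\<^sup>T))"
    by (rule assoc_mult_mat[OF f F mult_carrier_mat[OF Qt ut]])
  also have "?F * (?Q\<^sup>T * ?u\<^sup>T) = ?F * ?Q\<^sup>T * ?u\<^sup>T"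
    by (rule assoc_mult_mat[OF F Qt ut, symmetric])
  also have "?F * ?Q\<^sup>T = 1\<^sub>m ?n" using Cons by simp
  also have "1\<^sub>m ?n * ?u\<^sup>T = ?u\<^sup>T" by (rule left_mult_one_mat[OF ut])
  also have "?f * ?u\<^sup>T = 1\<^sub>m ?n" using Cons.prems by (intro elem_f_inverse) auto
  finally show ?case by (simp add: mat_prod_Cons)
qed

section \<open>The diagonal factors\<close>

lemma mat_prod_elem_d_carrier:
  "mat_prod r (map (elem_d r y) w) \<in> carrier_mat (r + 1) (r + 1)"
  by (rule mat_prod_carrier) (use elem_d_carrier in auto)

lemma index_mat_prod_elem_d:
  assumes "distinct w" "set w \<subseteq> {1..r + 1}" "a \<le> r" "b \<le> r"
  shows "mat_prod r (map (elem_d r y) w) $$ (a, b) =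
         (if a = b then if a + 1 \<in> set w then y (2 * (a + 1) - 1) else 1 else 0)"
  using assms
proof (induction w)
  case Nil
  then show ?case by (simp add: mat_prod_Nil)
next
  case (Cons k w)
  let ?M = "mat_prod r (map (elem_d r y) w)"
  have "mat_prod r (map (elem_d r y) (k # w)) $$ (a, b) =
        ?M $$ (a, b) + (if a + 1 = k then (y (2 * k - 1) - 1) * ?M $$ (k - 1, b) else 0)"
    using index_add_mat_unit_mult[OF mat_prod_elem_d_carrier, of a r b k "y (2 * k - 1) - 1" k y w] Cons.prems
    by (simp add: mat_prod_Cons elem_d_def)
  with Cons show ?case by (auto simp: algebra_simps)
qed

lemma index_mat_prod_elem_d_mult:
  assumes "M \<in> carrier_mat (r + 1) (r + 1)" "a \<le> r" "b \<le> r"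
  shows "(mat_prod r (map (elem_d r y) [1..<r + 2]) * M) $$ (a, b) = y (2 * (a + 1) - 1) * M $$ (a, b)"
proof -
  let ?D = "mat_prod r (map (elem_d r y) [1..<r + 2])"
  have D: "?D $$ (a, l) = (if a = l then y (2 * (a + 1) - 1) else 0)" if "l \<le> r" for l
    using index_mat_prod_elem_d[OF distinct_upt, of 1 "r + 2" r a l y] assms(2) that
    by (simp add: subset_iff del: upt_Suc)
  have "(?D * M) $$ (a, b) = (\<Sum>l = 0..<r + 1. ?D $$ (a, l) * M $$ (l, b))"
    using assms mat_prod_elem_d_carrier[of r y "[1..<r + 2]"]
    by (simp add: scalar_prod_def del: upt_Suc)
  also have "\<dots> = (\<Sum>l = 0..<r + 1. if l = a then y (2 * (a + 1) - 1) * M $$ (l, b) else 0)"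
  proof (intro sum.cong refl)
    fix l assume "l \<in> {0..<r + 1}"
    then show "?D $$ (a, l) * M $$ (l, b) = (if l = a then y (2 * (a + 1) - 1) * M $$ (l, b) else 0)"
      using D[of l] by (auto simp del: upt_Suc)
  qed
  also have "\<dots> = y (2 * (a + 1) - 1) * M $$ (a, b)"
    using assms by (subst sum.delta) auto
  finally show ?thesis .
qed


section \<open>Entries of the transfer matrix\<close>

lemma gamma_edge_loop_iff:
  "gamma_edge r m t y a a w \<longleftrightarrow> 1 \<le> a \<and> a \<le> r + 1 \<and> w = t * y (2 * a - 1)"
  using gamma_edge.loop[of a r m t y] by (auto elim: gamma_edge.cases)

text \<open>Maximality disappears, since every segment extends to a maximal one. The edges of a
  segment reach one vertex past its last index, hence \<open>b - 1\<close>; weight 1 of the short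
  edges is the case of exponent 0.\<close>

lemma gamma_edge_up_iff:
  assumes "a < b"
  shows "gamma_edge r m t y a b w \<longleftrightarrow>
    1 \<le> a \<and> b \<le> r + 1 \<and> (b = a + 1 \<or> segment r m 1 a (b - 1)) \<and> w = (-1) ^ (b - a - 1)"
proof
  assume "gamma_edge r m t y a b w"
  then show "1 \<le> a \<and> b \<le> r + 1 \<and> (b = a + 1 \<or> segment r m 1 a (b - 1)) \<and> w = (-1) ^ (b - a - 1)"
  proof cases
    case (ascending i \<alpha> q p)
    then have "segment r m 1 \<alpha> (\<alpha> + i - 1)" by (simp add: max_segment_def)
    moreover from this ascending have "segment r m 1 a (b - 1)"
      by (elim segment_mono) auto
    ultimately show ?thesis using ascending by (auto simp: segment_def)
  qed (use assms in auto)
next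
  assume *: "1 \<le> a \<and> b \<le> r + 1 \<and> (b = a + 1 \<or> segment r m 1 a (b - 1)) \<and> w = (-1) ^ (b - a - 1)"
  show "gamma_edge r m t y a b w"
  proof (cases "b = a + 1")
    case True
    with * gamma_edge.up[of a r m t y] show ?thesis by simp
  next
    case False
    with * have "segment r m 1 a (b - 1)" by simp
    then obtain \<alpha> \<beta> where \<alpha>\<beta>: "max_segment r m 1 \<alpha> \<beta>" "\<alpha> \<le> a" "b - 1 \<le> \<beta>"
      by (rule segment_extend)
    then have "\<alpha> < \<beta>" by (simp add: max_segment_def segment_def)
    with \<alpha>\<beta> * assms False gamma_edge.ascending[of "\<beta> - \<alpha> + 1" r m \<alpha> "a - \<alpha>" "b - \<alpha>" t y]
    show ?thesis by (simp add: le_diff_conv)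
  qed
qed

text \<open>As for the ascending edges; for \<open>a = b + 1\<close> the denominator is an empty
  product.\<close>

lemma gamma_edge_down_iff:
  assumes "b < a"
  shows "gamma_edge r m t y a b w \<longleftrightarrow>
    1 \<le> b \<and> a \<le> r + 1 \<and> (a = b + 1 \<or> segment r m (-1) b (a - 1)) \<and>
    w = t * ((\<Prod>j\<in>{b..a - 1}. y (2 * j)) / (\<Prod>j\<in>{b + 1..a - 1}. y (2 * j - 1)))"
    (is "_ \<longleftrightarrow> 1 \<le> b \<and> a \<le> r + 1 \<and> ?seg \<and> w = ?w")
proof
  assume "gamma_edge r m t y a b w"
  then show "1 \<le> b \<and> a \<le> r + 1 \<and> ?seg \<and> w = ?w"
  proof cases
    case (descending i \<alpha> q p)
    then have "segment r m (-1) \<alpha> (\<alpha> + i - 1)" by (simp add: max_segment_def)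
    moreover from this descending have "segment r m (-1) b (a - 1)"
      by (elim segment_mono) auto
    ultimately show ?thesis using descending by (auto simp: segment_def)
  qed (use assms in auto)
next
  assume *: "1 \<le> b \<and> a \<le> r + 1 \<and> ?seg \<and> w = ?w"
  show "gamma_edge r m t y a b w"
  proof (cases "a = b + 1")
    case True
    with * gamma_edge.down[of b r m t y] show ?thesis by simp
  next
    case False
    with * have "segment r m (-1) b (a - 1)" by simp
    then obtain \<alpha> \<beta> where \<alpha>\<beta>: "max_segment r m (-1) \<alpha> \<beta>" "\<alpha> \<le> b" "a - 1 \<le> \<beta>"
      by (rule segment_extend)
    then have "\<alpha> < \<beta>" by (simp add: max_segment_def segment_def)
    with \<alpha>\<beta> * assms False gamma_edge.descending[of "\<beta> - \<alpha> + 1" r m \<alpha> "b - \<alpha>" "a - \<alpha>" t y]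
    show ?thesis by (simp add: le_diff_conv)
  qed
qed

text \<open>Since \<open>P\<close> and \<open>v\<close> do not depend on \<open>w\<close>, the
  weight of an edge is unique and the description operator is resolved.\<close>

lemma index_transfer_matrix:
  assumes "a \<le> r" "b \<le> r" and "\<And>w. gamma_edge r m t y (a + 1) (b + 1) w \<longleftrightarrow> P \<and> w = v"
  shows "transfer_matrix r m t y $$ (b, a) = (if P then v else 0)"
  using assms by (auto simp: transfer_matrix_def)

lemma index_transfer_matrix_lower:
  assumes "a < b" "b \<le> r"
  shows "transfer_matrix r m t y $$ (b, a) =
         (if subseq [a + 1..<b + 1] (segment_word r m 1) then (-1) ^ (b - a - 1) else 0)"
  using assms
  by (intro index_transfer_matrix)
     (auto simp: gamma_edge_up_iff subseq_segment_word_iff simp del: upt_Suc)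

lemma index_transfer_matrix_upper:
  assumes "a \<le> b" "b \<le> r" "y (2 * (a + 1) - 1) \<noteq> 0"
  shows "transfer_matrix r m t y $$ (a, b) =
         (if subseq [a + 1..<b + 1] (segment_word r m (-1))
          then t * (y (2 * (a + 1) - 1) * (\<Prod>j = a + 1..<b + 1. y (2 * j) / y (2 * j - 1))) else 0)"
proof (cases "a = b")
  case True
  then show ?thesis
    using index_transfer_matrix[of a r a m t y True "t * y (2 * (a + 1) - 1)"] assms
    by (simp add: gamma_edge_loop_iff)
next
  case False
  have "y (2 * (a + 1) - 1) * (\<Prod>j = a + 1..<b + 1. y (2 * j) / y (2 * j - 1)) =
        (\<Prod>j\<in>{a + 1..b}. y (2 * j)) / (\<Prod>j\<in>{a + 2..b}. y (2 * j - 1))"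
  proof -
    have "{a + 1..<b + 1} = {a + 1..b}" by auto
    \<comment> \<open>The first denominator is the one that the diagonal factor cancels.\<close>
    moreover have "(\<Prod>j\<in>{a + 1..b}. y (2 * j - 1)) = y (2 * (a + 1) - 1) * (\<Prod>j\<in>{a + 2..b}. y (2 * j - 1))"
      using False assms(1) by (subst prod.atLeast_Suc_atMost) auto
    ultimately show ?thesis using assms(3) by (simp add: prod_dividef)
  qed
  then show ?thesis
    using False assms
    by (intro index_transfer_matrix) (auto simp: gamma_edge_down_iff subseq_segment_word_iff simp del: upt_Suc)
qed

section \<open>The decomposition\<close>

theorem lemma7p1:
  fixes r :: nat and m :: "nat \<Rightarrow> int"
    and R :: "nat \<Rightarrow> int \<Rightarrow> 'k::field_char_0 ratfun" and y :: "nat \<Rightarrow> 'k ratfun"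
    and t :: "'k ratfun" and N B :: "'k ratfun mat"
  assumes "r \<ge> 1" and "motzkin_path r m"
    and "q_system r R" and "y = weight_y R m"
    and "N \<in> carrier_mat (r + 1) (r + 1)" and "B \<in> carrier_mat (r + 1) (r + 1)"
    and "transfer_matrix r m t y = N + B"
    and "strictly_lower_triangular N" and "upper_triangular B"
  shows "(\<exists>F_inv. mat_inverse (mat_prod r (map (elem_f r) (sigma_seq r m))) = Some F_inv \<and>
            N = 1\<^sub>m (r + 1) - F_inv) \<and>
         B = t \<cdot>\<^sub>m (mat_prod r (map (elem_d r y) [1..<r + 2]) *
                  mat_prod r (map (elem_e r y) (tau_seq r m)))"
proof -
  let ?n = "r + 1"
  let ?\<sigma> = "segment_word r m 1" and ?\<tau> = "segment_word r m (-1)"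
  let ?F = "mat_prod r (map (elem_f r) ?\<sigma>) :: 'k ratfun mat"
  let ?Q = "mat_prod r (map (upper_unit r (\<lambda>_. -1)) ?\<sigma>) :: 'k ratfun mat"
  let ?c = "\<lambda>i. y (2 * i) / y (2 * i - 1)"
  let ?E = "mat_prod r (map (upper_unit r ?c) ?\<tau>)"
  let ?D = "mat_prod r (map (elem_d r y) [1..<r + 2])"
  have \<sigma>: "sigma_seq r m = ?\<sigma>" and \<tau>: "tau_seq r m = ?\<tau>"
    by (simp_all add: sigma_seq_def tau_seq_def segment_word_def)
  have e: "elem_e r y = upper_unit r ?c"
    by (simp add: fun_eq_iff elem_e_def upper_unit_def)
  have Fc: "?F \<in> carrier_mat ?n ?n"
    by (rule mat_prod_carrier) (use elem_f_carrier in auto)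
  have Qc: "?Q \<in> carrier_mat ?n ?n" and Ec: "?E \<in> carrier_mat ?n ?n"
    by (rule mat_prod_upper_unit_carrier)+
  have Dc: "?D \<in> carrier_mat ?n ?n" by (rule mat_prod_elem_d_carrier)
  have Qt: "?Q\<^sup>T \<in> carrier_mat ?n ?n" using Qc by simp
  have FQ: "?F * ?Q\<^sup>T = 1\<^sub>m ?n"
    by (rule mat_prod_elem_f_inverse) (simp add: set_segment_word)
  then have QF: "?Q\<^sup>T * ?F = 1\<^sub>m ?n"
    by (rule mat_mult_left_right_inverse[OF Fc Qt])
  \<comment> \<open>Being a unit of the matrix ring rules out the result \<open>None\<close> of
    \<open>mat_inverse\<close>.\<close>
  have "?F \<in> Units (ring_mat TYPE('k ratfun) ?n ())"
    using Fc Qt FQ QF unfolding Units_def by (auto simp: ring_mat_simps)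
  then obtain F' where F': "mat_inverse ?F = Some F'"
    using mat_inverse(1)[OF Fc, where b = "()"] by (cases "mat_inverse ?F") auto
  then have F'2: "F' * ?F = 1\<^sub>m ?n" "F' \<in> carrier_mat ?n ?n"
    using mat_inverse(2)[OF Fc] by blast+
  \<comment> \<open>Uniqueness of inverses identifies the computed inverse with the transpose, whose
    entries are known.\<close>
  have "F' = F' * (?F * ?Q\<^sup>T)" using F'2 FQ by simp
  also have "\<dots> = F' * ?F * ?Q\<^sup>T" by (rule assoc_mult_mat[symmetric, OF F'2(2) Fc Qt])
  also have "\<dots> = ?Q\<^sup>T" unfolding F'2(1) by (rule left_mult_one_mat[OF Qt])
  finally have F'_eq: "F' = ?Q\<^sup>T" .

  have T: "transfer_matrix r m t y $$ (i, j) = N $$ (i, j) + B $$ (i, j)" if "i \<le> r" "j \<le> r" for i j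
    using assms(5-7) that by simp
  have N0: "N $$ (i, j) = 0" if "i \<le> j" "j \<le> r" for i j
    using assms(5,8) that by (auto simp: strictly_lower_triangular_def)
  have B0: "B $$ (i, j) = 0" if "j < i" "i \<le> r" for i j
    using assms(6,9) that by (auto simp: upper_triangular_def)
  have w: "distinct (segment_word r m s)" "set (segment_word r m s) \<subseteq> {1..r}" for s
    by (simp_all add: distinct_segment_word set_segment_word)

  have "N = 1\<^sub>m ?n - F'"
  proof (rule eq_matI)
    fix b a assume "b < dim_row (1\<^sub>m ?n - F')" "a < dim_col (1\<^sub>m ?n - F')"
    then have ab: "a \<le> r" "b \<le> r" using F'2 by auto
    \<comment> \<open>Transposition turns the entry (b, a) into the entry (a, b) of
      \<open>?Q\<close>. On the diagonal the empty run gives 1, which cancels the identity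
      matrix.\<close>
    have *: "(1\<^sub>m ?n - F') $$ (b, a) = (if a = b then 1 else 0) -
        (if a \<le> b \<and> subseq [a + 1..<b + 1] ?\<sigma> then (-1) ^ (b - a) else 0)"
      using ab Qc index_mat_prod_upper_unit[OF w ab, where c = "\<lambda>_. -1 :: 'k ratfun"]
      by (auto simp: F'_eq simp del: upt_Suc)
    show "N $$ (b, a) = (1\<^sub>m ?n - F') $$ (b, a)"
    proof (cases "a < b")
      case True
      \<comment> \<open>The product has one sign for each of the \<open>b - a\<close> letters; the
        minus sign before \<open>F'\<close> removes one and yields the edge weight.\<close>
      then have "- ((-1) ^ (b - a)) = ((-1) ^ (b - a - 1) :: 'k ratfun)"
        using power_Suc[of "-1 :: 'k ratfun" "b - a - 1"] by (simp add: Suc_diff_Suc)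
      then show ?thesis
        unfolding *
        using True T[OF ab(2,1)] B0[OF True ab(2)] index_transfer_matrix_lower[OF True ab(2), of m t y]
        by (auto simp del: upt_Suc)
    next
      case False
      then show ?thesis unfolding * using N0[of b a] ab by auto
    qed
  qed (use assms(5) F'2 in auto)
  moreover have "B = t \<cdot>\<^sub>m (?D * ?E)"
  proof (rule eq_matI)
    fix a b assume "a < dim_row (t \<cdot>\<^sub>m (?D * ?E))" "b < dim_col (t \<cdot>\<^sub>m (?D * ?E))"
    then have ab: "a \<le> r" "b \<le> r" using Dc Ec by auto
    have *: "(t \<cdot>\<^sub>m (?D * ?E)) $$ (a, b) = t * (y (2 * (a + 1) - 1) *
        (if a \<le> b \<and> subseq [a + 1..<b + 1] ?\<tau> then \<Prod>j = a + 1..<b + 1. ?c j else 0))"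
      using ab Dc Ec index_mat_prod_elem_d_mult[OF Ec ab, of y] index_mat_prod_upper_unit[OF w ab, where c = ?c]
      by (simp del: upt_Suc)
    show "B $$ (a, b) = (t \<cdot>\<^sub>m (?D * ?E)) $$ (a, b)"
    proof (cases "a \<le> b")
      case True
      \<comment> \<open>The only use of the Q-system: without this, division by zero would spoil the
        cancellation.\<close>
      have "y (2 * (a + 1) - 1) \<noteq> 0"
        unfolding assms(4) using ab by (intro weight_y_odd_nonzero[OF assms(3)]) auto
      then show ?thesis
        unfolding *
        using T[OF ab] N0[OF True ab(2)] index_transfer_matrix_upper[OF True ab(2), of y m t] True
        by (auto simp del: upt_Suc)
    next
      case False
      then show ?thesis unfolding * using B0[of b a] ab by simp
    qed
  qed (use assms(6) Dc Ec in auto)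
  ultimately show ?thesis
    unfolding \<sigma> \<tau> e using F' by blast
qed

end
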